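(* Let $G$ be a finite solvable group and let $H$ be a weak second maximal subgroup of $G$. Then there exists at most one member $X$ of $\mathrm{Max}(G,H)$ such that $H$ is not a maximal subgroup of $X$.
   Context: All groups are finite. A maximal subgroup of a group is a proper subgroup not properly contained in any other proper subgroup. For a proper subgroup $H$ of $G$, $\mathrm{Max}(G,H)$ denotes the set of all maximal subgroups of $G$ containing $H$. A proper subgroup $H$ of $G$ is a weak second maximal subgroup of $G$ if $H$ is a maximal subgroup of some member of $\mathrm{Max}(G,H)$. *)

theory Defs
  imports "HOL-Algebra.Algebra"
begin

definition maximal_subgroup :: "'a set \<Rightarrow> ('a, 'b) monoid_scheme \<Rightarrow> bool" where
  "maximal_subgroup M G \<longleftrightarrow>
     subgroup M G \<and> M \<noteq> carrier G \<and>
     \<not> (\<exists>K. subgroup K G \<and> K \<noteq> carrier G \<and> M \<subset> K)"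

definition Max_subgroups :: "('a, 'b) monoid_scheme \<Rightarrow> 'a set \<Rightarrow> 'a set set" where
  "Max_subgroups G H = {M. maximal_subgroup M G \<and> H \<subseteq> M}"

(* A subgroup M of G, viewed as a group in its own right, is G\<lparr>carrier := M\<rparr>. *)
definition weak_second_maximal :: "'a set \<Rightarrow> ('a, 'b) monoid_scheme \<Rightarrow> bool" where
  "weak_second_maximal H G \<longleftrightarrow>
     subgroup H G \<and> H \<noteq> carrier G \<and>
     (\<exists>M \<in> Max_subgroups G H. maximal_subgroup H (G\<lparr>carrier := M\<rparr>))"

end

theory Submission
  imports Defs
begin

text \<open>
  Let \<open>H\<close> be maximal in the maximal subgroup \<open>M\<close>, and call \<open>Y \<in> Max(G,H)\<close> bad if \<open>H\<close> is not
  maximal in \<open>Y\<close>; then \<open>Y \<noteq> M\<close> and \<open>Y \<inter> M = H\<close>. By solvability there is a normal subgroup \<open>N\<close>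
  of \<open>G\<close> with \<open>N \<not>\<subseteq> M\<close> whose commutator subgroup and all of whose proper \<open>G\<close>-normal
  subgroups lie in \<open>M\<close>; modulo the core of \<open>M\<close> it covers the socle of a primitive solvable
  group. The claim is that \<open>Y = NH\<close> for every bad \<open>Y\<close>, which gives uniqueness since \<open>N\<close> is chosen
  independently of \<open>Y\<close>.

  Correspondence of subgroups along \<open>G/A \<cong> Y/(A \<inter> Y)\<close> for a normal supplement \<open>A\<close> of \<open>Y\<close> shows:
  if \<open>A\<close> lies in a maximal subgroup \<open>S\<close>, then \<open>S \<inter> Y\<close> is maximal in \<open>Y\<close>
  (\<open>maximal_inter_supplement\<close>); and if \<open>H \<supseteq> A \<inter> Y\<close> is maximal in \<open>Y\<close>, then \<open>AH\<close> is maximal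
  in \<open>G\<close> (\<open>maximal_mult_supplement\<close>). By the first fact with \<open>S = M\<close>, every normal subgroup of
  \<open>G\<close> inside \<open>M\<close> lies in a bad \<open>Y\<close>, hence in \<open>Y \<inter> M = H\<close>. In particular \<open>Y\<close> contains the
  commutator subgroup of \<open>N\<close>.

  If \<open>N \<subseteq> Y\<close>, then \<open>Y = N(Y \<inter> M) = NH\<close> by the modular law. Suppose \<open>N \<not>\<subseteq> Y\<close>. Then
  \<open>NY = NM = G\<close>, and \<open>N \<inter> Y\<close> and \<open>N \<inter> M\<close> are normal in \<open>G\<close> and properly contained in \<open>N\<close>,
  so both lie in \<open>H\<close>. Hence \<open>NH\<close> is maximal in \<open>G\<close> by the second fact, and \<open>NH \<inter> Y\<close> is maximal
  in \<open>Y\<close> by the first. But \<open>NH \<inter> Y = (N \<inter> Y)H = H\<close>, contrary to the badness of \<open>Y\<close>.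
\<close>

section \<open>Maximal subgroups\<close>

lemma maximal_subgroupD:
  assumes "maximal_subgroup M G"
  shows "subgroup M G" "M \<noteq> carrier G"
    and "\<And>K. \<lbrakk>subgroup K G; M \<subseteq> K; K \<noteq> M\<rbrakk> \<Longrightarrow> K = carrier G"
  using assms unfolding maximal_subgroup_def by auto

lemma (in group) maximal_subgroup_restrict_iff:
  assumes Y: "subgroup Y G"
  shows "maximal_subgroup H (G\<lparr>carrier := Y\<rparr>) \<longleftrightarrow>
    subgroup H G \<and> H \<subset> Y \<and> (\<forall>K. subgroup K G \<longrightarrow> H \<subset> K \<longrightarrow> K \<subseteq> Y \<longrightarrow> K = Y)"
proof -
  have "subgroup K (G\<lparr>carrier := Y\<rparr>) \<longleftrightarrow> subgroup K G \<and> K \<subseteq> Y" for K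
    using subgroup_incl[OF _ Y] incl_subgroup[OF Y] subgroup.subset[of K "G\<lparr>carrier := Y\<rparr>"]
    by auto
  then show ?thesis
    unfolding maximal_subgroup_def by auto
qed

lemma (in group) maximal_subgroups_inter:
  assumes M: "maximal_subgroup M G" and Y: "maximal_subgroup Y G" and "Y \<noteq> M"
    and H: "maximal_subgroup H (G\<lparr>carrier := M\<rparr>)" and "H \<subseteq> Y"
  shows "Y \<inter> M = H"
proof -
  have "Y \<inter> M \<noteq> M"
    using maximal_subgroupD[OF M] maximal_subgroupD[OF Y] \<open>Y \<noteq> M\<close> by blast
  moreover have "subgroup (Y \<inter> M) G"
    using M Y by (simp add: maximal_subgroupD(1) subgroups_Inter_pair)
  ultimately show ?thesis
    using H \<open>H \<subseteq> Y\<close>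
    unfolding maximal_subgroup_restrict_iff[OF maximal_subgroupD(1)[OF M]] by blast
qed

section \<open>Normal supplements\<close>

lemma (in group) subset_set_mult_left:
  assumes "A \<subseteq> carrier G" "subgroup B G"
  shows "A \<subseteq> A <#> B"
proof
  fix a assume "a \<in> A"
  then have "a = a \<otimes> \<one>" using assms(1) by auto
  with \<open>a \<in> A\<close> show "a \<in> A <#> B"
    unfolding set_mult_def using subgroup.one_closed[OF assms(2)] by blast
qed

lemma (in group) subset_set_mult_right:
  assumes "subgroup A G" "B \<subseteq> carrier G"
  shows "B \<subseteq> A <#> B"
proof
  fix b assume "b \<in> B"
  then have "b = \<one> \<otimes> b" using assms(2) by auto
  with \<open>b \<in> B\<close> show "b \<in> A <#> B"
    unfolding set_mult_def using subgroup.one_closed[OF assms(1)] by blast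
qed

lemma (in group) set_mult_subgroup_closed:
  assumes "subgroup T G" "A \<subseteq> T" "B \<subseteq> T"
  shows "A <#> B \<subseteq> T"
  using assms subgroup.m_closed[OF assms(1)] unfolding set_mult_def by blast

text \<open>Dedekind's modular law, in the direction that is not immediate.\<close>

lemma (in group) modular_law:
  assumes A: "subgroup A G" and T: "subgroup T G" and Y: "Y \<subseteq> carrier G"
    and "A \<subseteq> T" and "T \<subseteq> A <#> Y"
  shows "T \<subseteq> A <#> (T \<inter> Y)"
proof
  fix t assume t: "t \<in> T"
  then obtain a x where ax: "a \<in> A" "x \<in> Y" "t = a \<otimes> x"
    using \<open>T \<subseteq> A <#> Y\<close> unfolding set_mult_def by blast
  have "x = inv a \<otimes> t"
    using ax A Y by (metis inv_solve_left m_closed subgroup.mem_carrier subsetD)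
  moreover have "inv a \<in> T"
    using ax(1) \<open>A \<subseteq> T\<close> T by (auto intro: subgroup.m_inv_closed)
  ultimately have "x \<in> T"
    using t T by (simp add: subgroup.m_closed)
  with ax show "t \<in> A <#> (T \<inter> Y)" unfolding set_mult_def by blast
qed

lemma (in group) set_mult_inter_subset:
  assumes A: "subgroup A G" and H: "subgroup H G" and Y: "subgroup Y G"
    and "H \<subseteq> Y" and "A \<inter> Y \<subseteq> H"
  shows "(A <#> H) \<inter> Y \<subseteq> H"
proof
  fix x assume x: "x \<in> (A <#> H) \<inter> Y"
  then obtain a h where ah: "a \<in> A" "h \<in> H" "x = a \<otimes> h"
    unfolding set_mult_def by blast
  have "a = x \<otimes> inv h"
    using ah A H by (metis inv_solve_right m_closed subgroup.mem_carrier)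
  then have "a \<in> Y"
    using x ah(2) \<open>H \<subseteq> Y\<close> Y by (auto intro: subgroup.m_closed subgroup.m_inv_closed)
  then have "a \<in> H" using ah(1) \<open>A \<inter> Y \<subseteq> H\<close> by blast
  then show "x \<in> H" using ah H by (simp add: subgroup.m_closed)
qed

lemma (in group) maximal_supplement:
  assumes Y: "maximal_subgroup Y G" and A: "A \<lhd> G" and "\<not> A \<subseteq> Y"
  shows "A <#> Y = carrier G"
proof -
  have sY: "subgroup Y G" and sA: "subgroup A G"
    using Y A by (simp_all add: maximal_subgroupD(1) normal_imp_subgroup)
  have "A \<subseteq> A <#> Y" "Y \<subseteq> A <#> Y"
    using subset_set_mult_left[OF subgroup.subset[OF sA] sY]
      subset_set_mult_right[OF sA subgroup.subset[OF sY]] by auto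
  with maximal_subgroupD(3)[OF Y mult_norm_subgroup[OF A sY]] \<open>\<not> A \<subseteq> Y\<close> show ?thesis
    by blast
qed

lemma (in group) maximal_inter_supplement:
  assumes S: "maximal_subgroup S G" and Y: "subgroup Y G"
    and A: "A \<lhd> G" "A \<subseteq> S" "A <#> Y = carrier G"
  shows "maximal_subgroup (S \<inter> Y) (G\<lparr>carrier := Y\<rparr>)"
  unfolding maximal_subgroup_restrict_iff[OF Y]
proof (intro conjI allI impI)
  note sS = maximal_subgroupD(1)[OF S] and sA = normal_imp_subgroup[OF A(1)]
  show "subgroup (S \<inter> Y) G" using sS Y by (rule subgroups_Inter_pair)
  have "\<not> Y \<subseteq> S"
    using set_mult_subgroup_closed[OF sS A(2), of Y] A(3) maximal_subgroupD(2)[OF S]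
      subgroup.subset[OF sS] by blast
  then show "S \<inter> Y \<subset> Y" by blast
  fix T assume T: "subgroup T G" "S \<inter> Y \<subset> T" "T \<subseteq> Y"
  \<comment> \<open>\<open>AT\<close> contains \<open>S = A(S \<inter> Y)\<close> but differs from it, so it is all of \<open>G\<close>.\<close>
  have AT: "subgroup (A <#> T) G" using A(1) T(1) by (rule mult_norm_subgroup)
  have "S \<subseteq> A <#> (S \<inter> Y)"
    using modular_law[OF sA sS subgroup.subset[OF Y] A(2)] A(3) subgroup.subset[OF sS] by simp
  also have "\<dots> \<subseteq> A <#> T" using T(2) by (intro mono_set_mult) auto
  finally have "S \<subseteq> A <#> T" .
  moreover have "T \<subseteq> A <#> T"
    using sA subgroup.subset[OF T(1)] by (rule subset_set_mult_right)
  then have "A <#> T \<noteq> S" using T(2,3) by blast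
  ultimately have AT_eq: "A <#> T = carrier G"
    by (rule maximal_subgroupD(3)[OF S AT])
  show "T = Y"
  proof (rule subset_antisym[OF T(3)], rule subsetI)
    fix x assume x: "x \<in> Y"
    then obtain a t where at: "a \<in> A" "t \<in> T" "x = a \<otimes> t"
      using AT_eq subgroup.subset[OF Y] unfolding set_mult_def by blast
    have "a = x \<otimes> inv t"
      using at sA T(1) by (metis inv_solve_right m_closed subgroup.mem_carrier)
    then have "a \<in> Y"
      using x at(2) T(3) Y by (auto intro: subgroup.m_closed subgroup.m_inv_closed)
    then have "a \<in> T" using at(1) A(2) T(2) by blast
    then show "x \<in> T" using at T(1) by (simp add: subgroup.m_closed)
  qed
qed

lemma (in group) maximal_mult_supplement:
  assumes Y: "subgroup Y G" and H: "maximal_subgroup H (G\<lparr>carrier := Y\<rparr>)"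
    and A: "A \<lhd> G" "A <#> Y = carrier G" "A \<inter> Y \<subseteq> H"
  shows "maximal_subgroup (A <#> H) G"
proof -
  note sA = normal_imp_subgroup[OF A(1)]
  have sH: "subgroup H G" and HY: "H \<subset> Y"
    and max: "\<And>K. \<lbrakk>subgroup K G; H \<subset> K; K \<subseteq> Y\<rbrakk> \<Longrightarrow> K = Y"
    using H unfolding maximal_subgroup_restrict_iff[OF Y] by blast+
  have AH: "subgroup (A <#> H) G" using A(1) sH by (rule mult_norm_subgroup)
  have A_AH: "A \<subseteq> A <#> H" using subgroup.subset[OF sA] sH by (rule subset_set_mult_left)
  have H_AH: "H \<subseteq> A <#> H" using sA subgroup.subset[OF sH] by (rule subset_set_mult_right)
  have inter: "(A <#> H) \<inter> Y \<subseteq> H"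
    using set_mult_inter_subset[OF sA sH Y] HY A(3) by blast
  have "T = carrier G" if T: "subgroup T G" "A <#> H \<subset> T" for T
  proof -
    have "A \<subseteq> T" "H \<subseteq> T" using A_AH H_AH T(2) by blast+
    have dec: "T \<subseteq> A <#> (T \<inter> Y)"
      using modular_law[OF sA T(1) subgroup.subset[OF Y] \<open>A \<subseteq> T\<close>] A(2)
        subgroup.subset[OF T(1)] by simp
    then have "T \<inter> Y \<noteq> H" using T(2) by auto
    then have "T \<inter> Y = Y"
      using max[OF subgroups_Inter_pair[OF T(1) Y]] \<open>H \<subseteq> T\<close> HY by blast
    then have "carrier G \<subseteq> T"
      using set_mult_subgroup_closed[OF T(1) \<open>A \<subseteq> T\<close>, of Y] A(2) by blast
    then show ?thesis using subgroup.subset[OF T(1)] by blast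
  qed
  moreover have "A <#> H \<noteq> carrier G"
    using inter HY subgroup.subset[OF Y] by blast
  ultimately show ?thesis
    unfolding maximal_subgroup_def using AH by blast
qed

section \<open>A normal subgroup that is abelian modulo a maximal subgroup\<close>

text \<open>
  \<open>N \<inter> Y\<close> is normalized by \<open>Y\<close>, and also by \<open>N\<close>: for \<open>n \<in> N\<close> and \<open>z \<in> N \<inter> Y\<close> the conjugate
  \<open>n z n\<inverse> = [n, z] z\<close> lies in \<open>Y\<close> because \<open>[n, z]\<close> does.
\<close>

lemma (in group) normal_inter_supplement:
  assumes N: "N \<lhd> G" and Y: "subgroup Y G" and NY: "N <#> Y = carrier G"
    and der: "derived G N \<subseteq> Y"
  shows "N \<inter> Y \<lhd> G"
proof (rule normal_invI)
  note sN = normal_imp_subgroup[OF N]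
  show "subgroup (N \<inter> Y) G" using sN Y by (rule subgroups_Inter_pair)
  fix g y assume g: "g \<in> carrier G" and y: "y \<in> N \<inter> Y"
  obtain n x where nx: "n \<in> N" "x \<in> Y" "g = n \<otimes> x"
    using g NY unfolding set_mult_def by blast
  have c: "n \<in> carrier G" "x \<in> carrier G" "y \<in> carrier G"
    using nx y sN Y by (auto intro: subgroup.mem_carrier)
  define z where "z = x \<otimes> y \<otimes> inv x"
  have zc: "z \<in> carrier G" using c by (simp add: z_def)
  have zN: "z \<in> N" unfolding z_def using normal.inv_op_closed2[OF N c(2)] y by blast
  have zY: "z \<in> Y" unfolding z_def
    using nx(2) y Y by (auto intro: subgroup.m_closed subgroup.m_inv_closed)
  have "n \<otimes> z \<otimes> inv n \<otimes> inv z \<in> derived G N"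
    unfolding derived_def by (rule generate.incl) (use nx(1) zN in blast)
  then have "(n \<otimes> z \<otimes> inv n \<otimes> inv z) \<otimes> z \<in> Y"
    using der zY Y by (auto intro: subgroup.m_closed)
  moreover have "(n \<otimes> z \<otimes> inv n \<otimes> inv z) \<otimes> z = n \<otimes> z \<otimes> inv n"
    using c zc by (simp add: m_assoc)
  moreover have "n \<otimes> z \<otimes> inv n = g \<otimes> y \<otimes> inv g"
    unfolding z_def nx(3) using c by (simp add: m_assoc inv_mult_group)
  ultimately have "g \<otimes> y \<otimes> inv g \<in> Y" by simp
  moreover have "g \<otimes> y \<otimes> inv g \<in> N"
    using normal.inv_op_closed2[OF N g] y by blast
  ultimately show "g \<otimes> y \<otimes> inv g \<in> N \<inter> Y" by blast
qed

lemma (in group) solvable_derived_neq: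
  assumes "solvable G" and N: "subgroup N G" and "N \<noteq> {\<one>}"
  shows "derived G N \<noteq> N"
proof
  assume eq: "derived G N = N"
  obtain n where n: "(derived G ^^ n) N = {\<one>}"
    using solvable_imp_trivial_derived_seq[OF solvable_subgroup[OF N \<open>solvable G\<close>]] by blast
  have "(derived G ^^ n) N = N" by (induction n) (simp_all add: eq)
  with n \<open>N \<noteq> {\<one>}\<close> show False by simp
qed

text \<open>
  Minimality gives \<open>derived G N \<subseteq> M\<close>, since solvability makes the commutator subgroup of \<open>N\<close>
  proper in \<open>N\<close>.
\<close>

lemma (in group) exists_minimal_normal_not_subset:
  assumes "finite (carrier G)" "solvable G" and M: "maximal_subgroup M G"
  obtains N where "N \<lhd> G" "\<not> N \<subseteq> M" "derived G N \<subseteq> M"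
    "\<And>L. \<lbrakk>L \<lhd> G; L \<subset> N\<rbrakk> \<Longrightarrow> L \<subseteq> M"
proof -
  note sM = maximal_subgroupD(1)[OF M]
  let ?P = "\<lambda>N. N \<lhd> G \<and> \<not> N \<subseteq> M"
  have "?P (carrier G)"
    using normal_self maximal_subgroupD(2)[OF M] subgroup.subset[OF sM] by blast
  then obtain N where N: "?P N" and least: "\<And>L. ?P L \<Longrightarrow> card N \<le> card L"
    using ex_has_least_nat[of ?P _ card] by blast
  have sN: "subgroup N G" using N normal_imp_subgroup by blast
  have "finite N" using \<open>finite (carrier G)\<close> subgroup.subset[OF sN] by (rule rev_finite_subset)
  have small: "L \<subseteq> M" if "L \<lhd> G" "L \<subset> N" for L
  proof (rule ccontr)
    assume "\<not> L \<subseteq> M"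
    then have "card N \<le> card L" using least \<open>L \<lhd> G\<close> by blast
    moreover have "card L < card N" using \<open>finite N\<close> \<open>L \<subset> N\<close> by (rule psubset_card_mono)
    ultimately show False by simp
  qed
  have "N \<noteq> {\<one>}" using N subgroup.one_closed[OF sM] by blast
  then have "derived G N \<subset> N"
    using solvable_derived_neq[OF \<open>solvable G\<close> sN] derived_incl[OF subset_refl sN] by blast
  then have "derived G N \<subseteq> M" using small derived_is_normal N by blast
  then show thesis using that N small by blast
qed

section \<open>Uniqueness of the bad maximal overgroup\<close>

text \<open>
  If a normal subgroup \<open>L\<close> of \<open>G\<close> inside \<open>M\<close> were not contained in \<open>Y\<close>, it would supplement \<open>Y\<close>,
  and then \<open>H = M \<inter> Y\<close> would be maximal in \<open>Y\<close> by \<open>maximal_inter_supplement\<close>.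
\<close>

lemma (in group) normal_subset_inter:
  assumes M: "maximal_subgroup M G" and Y: "maximal_subgroup Y G" and MY: "Y \<inter> M = H"
    and bad: "\<not> maximal_subgroup H (G\<lparr>carrier := Y\<rparr>)"
    and L: "L \<lhd> G" "L \<subseteq> M"
  shows "L \<subseteq> H"
proof (rule ccontr)
  assume "\<not> L \<subseteq> H"
  then have "\<not> L \<subseteq> Y" using L(2) MY by blast
  then have "maximal_subgroup (M \<inter> Y) (G\<lparr>carrier := Y\<rparr>)"
    using maximal_inter_supplement[OF M maximal_subgroupD(1)[OF Y] L]
      maximal_supplement[OF Y L(1)] by blast
  then show False using bad MY by (simp add: Int_commute)
qed

lemma (in group) bad_overgroup_eq:
  assumes M: "maximal_subgroup M G" and H: "maximal_subgroup H (G\<lparr>carrier := M\<rparr>)"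
    and Y: "maximal_subgroup Y G" "H \<subseteq> Y" "\<not> maximal_subgroup H (G\<lparr>carrier := Y\<rparr>)"
    and N: "N \<lhd> G" "\<not> N \<subseteq> M" "derived G N \<subseteq> M"
    and small: "\<And>L. \<lbrakk>L \<lhd> G; L \<subset> N\<rbrakk> \<Longrightarrow> L \<subseteq> M"
  shows "Y = N <#> H"
proof -
  note sM = maximal_subgroupD(1)[OF M] and sY = maximal_subgroupD(1)[OF Y(1)]
    and sN = normal_imp_subgroup[OF N(1)]
  have sH: "subgroup H G" using H unfolding maximal_subgroup_restrict_iff[OF sM] by blast
  have MY: "Y \<inter> M = H"
    using maximal_subgroups_inter[OF M Y(1) _ H Y(2)] H Y(3) by blast
  note inH = normal_subset_inter[OF M Y(1) MY Y(3)]
  have NM: "N <#> M = carrier G" using maximal_supplement[OF M N(1,2)] .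
  have "N \<subseteq> Y"
  proof (rule ccontr)
    assume NY: "\<not> N \<subseteq> Y"
    have supp: "N <#> Y = carrier G" using maximal_supplement[OF Y(1) N(1) NY] .
    have "derived G N \<subseteq> Y"
      using inH[OF derived_is_normal[OF N(1)] N(3)] Y(2) by blast
    then have "N \<inter> Y \<lhd> G" using normal_inter_supplement[OF N(1) sY supp] by blast
    moreover from this have "N \<inter> Y \<subseteq> M" using small NY by blast
    ultimately have NYH: "N \<inter> Y \<subseteq> H" by (rule inH)
    have "N \<inter> M \<subseteq> H" using inH[OF normal_inter_supplement[OF N(1) sM NM N(3)]] by blast
    then have "maximal_subgroup (N <#> H) G"
      by (rule maximal_mult_supplement[OF sM H N(1) NM])
    then have max: "maximal_subgroup ((N <#> H) \<inter> Y) (G\<lparr>carrier := Y\<rparr>)"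
      using sY N(1) subset_set_mult_left[OF subgroup.subset[OF sN] sH] supp
      by (rule maximal_inter_supplement)
    have "(N <#> H) \<inter> Y \<subseteq> H"
      using set_mult_inter_subset[OF sN sH sY Y(2) NYH] .
    then have "(N <#> H) \<inter> Y = H"
      using subset_set_mult_right[OF sN subgroup.subset[OF sH]] Y(2) by blast
    with max Y(3) show False by simp
  qed
  show ?thesis
  proof
    show "Y \<subseteq> N <#> H"
      using modular_law[OF sN sY subgroup.subset[OF sM] \<open>N \<subseteq> Y\<close>] NM MY
        subgroup.subset[OF sY] by simp
    show "N <#> H \<subseteq> Y" using sY \<open>N \<subseteq> Y\<close> Y(2) by (rule set_mult_subgroup_closed)
  qed
qed

theorem theoremB:
  fixes G :: "('a, 'b) monoid_scheme" and H :: "'a set"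
  assumes "group G" and "finite (carrier G)" and "solvable G"
    and "weak_second_maximal H G"
  shows "\<exists>\<^sub>\<le>\<^sub>1 M. M \<in> Max_subgroups G H \<and> \<not> maximal_subgroup H (G\<lparr>carrier := M\<rparr>)"
proof -
  interpret group G by fact
  obtain M where M: "maximal_subgroup M G" "maximal_subgroup H (G\<lparr>carrier := M\<rparr>)"
    using assms(4) unfolding weak_second_maximal_def Max_subgroups_def by blast
  obtain N where N: "N \<lhd> G" "\<not> N \<subseteq> M" "derived G N \<subseteq> M"
    and small: "\<And>L. \<lbrakk>L \<lhd> G; L \<subset> N\<rbrakk> \<Longrightarrow> L \<subseteq> M"
    using exists_minimal_normal_not_subset[OF assms(2,3) M(1)] by blast
  have "Y = N <#>\<^bsub>G\<^esub> H"
    if "Y \<in> Max_subgroups G H" "\<not> maximal_subgroup H (G\<lparr>carrier := Y\<rparr>)" for Y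
    using bad_overgroup_eq[OF M _ _ _ N small] that unfolding Max_subgroups_def by blast
  then show ?thesis by (metis (no_types, lifting) Uniq_I)
qed

end
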